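(* Let $\Lambda$ be a nonempty set, and for each $\lambda\in\Lambda$ let $n(\lambda)\in\mathbb{N}\cup\{\infty\}$ and let $\alpha(\lambda,k)$, $k\in I_{n(\lambda)}$, be a strictly increasing (finite or infinite) sequence of positive numbers. Let $X_\lambda=Exp(\alpha(\lambda,k)\mid k\in I_{n(\lambda)})\subset C_\infty[0,\infty)$ and $\beta(\lambda)=\sum_{k\in I_{n(\lambda)}}\frac{1}{\alpha(\lambda,k)}$. Suppose that there exists $\Delta>0$ such that for every $\lambda\in\Lambda$ the sequence $\alpha(\lambda,k)$, $k\in I_{n(\lambda)}$, satisfies the $\Delta$-gap condition. If the family $\beta(\lambda)$, $\lambda\in\Lambda$, is bounded (i.e. there is a real $C$ with $\beta(\lambda)\leqslant C$ for all $\lambda\in\Lambda$), then the family $(X_\lambda)_{\lambda\in\Lambda}$ is not an absolutely representing family of subspaces (ARFS) in $C_\infty[0,\infty)$.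
   Context: $\mathbb{K}$ is $\mathbb{R}$ or $\mathbb{C}$. $C_\infty[0,\infty)$ is the Banach space of all continuous functions $f:[0,\infty)\to\mathbb{K}$ with $\lim_{t\to\infty}f(t)=0$, with norm $\|f\|=\sup_{t\geqslant 0}|f(t)|$. $I_n=\{1,\ldots,n\}$ for $n\in\mathbb{N}$, and $I_\infty=\{1,2,\ldots\}$. For pairwise distinct positive numbers $\alpha_k$, $k\in I_n$ ($n\in\mathbb{N}\cup\{\infty\}$), $Exp(\alpha_k\mid k\in I_n)$ is the closed linear span in $C_\infty[0,\infty)$ of the functions $t\mapsto e^{-\alpha_k t}$, $k\in I_n$. A strictly increasing sequence $\alpha_k$, $k\in I_n$, satisfies the $\Delta$-gap condition if $\alpha_{k+1}-\alpha_k\geqslant\Delta$ whenever $k,k+1\in I_n$ (no condition if $n=1$). A family $(X_\lambda)_{\lambda\in\Lambda}$ of closed linear subspaces of a Banach space $X$ is an absolutely representing family of subspaces (ARFS) in $X$ if for every $x\in X$ there exist $x_\lambda\in X_\lambda$, $\lambda\in\Lambda$, such that $\sum_{\lambda\in\Lambda}\|x_\lambda\|<\infty$ and $x=\sum_{\lambda\in\Lambda}x_\lambda$. *)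

theory Defs
  imports "HOL-Analysis.Analysis" "HOL-Library.Extended_Nat"
begin

text \<open>
  The space \<open>C\<^sub>\<infinity>[0,\<infinity>)\<close> of continuous functions vanishing at infinity, with values in the scalar
  field \<open>'k\<close> (to be instantiated with \<open>real\<close> and \<open>complex\<close>). A function on \<open>[0,\<infinity>)\<close> is encoded as a
  function on \<open>real\<close> with the dummy value \<open>0\<close> at negative arguments, so that equality of
  representatives is equality on \<open>[0,\<infinity>)\<close>; no continuity across \<open>0\<close> is required.
\<close>

typedef (overloaded) 'k Cinf =
  "{f :: real \<Rightarrow> 'k::real_normed_field.
      continuous_on {0..} f \<and> (f \<longlongrightarrow> 0) at_top \<and> (\<forall>t<0. f t = 0)}"
  morphisms apply_Cinf Cinf
  by (rule exI[of _ "\<lambda>_. 0"]) auto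

setup_lifting type_definition_Cinf

lemma Cinf_continuous: "continuous_on {0..} (apply_Cinf f)"
  and Cinf_tendsto: "(apply_Cinf f \<longlongrightarrow> 0) at_top"
  and Cinf_neg: "t < 0 \<Longrightarrow> apply_Cinf f t = 0"
  using apply_Cinf[of f] by auto

lemma Cinf_eqI: "(\<And>t. t \<ge> 0 \<Longrightarrow> apply_Cinf f t = apply_Cinf g t) \<Longrightarrow> f = g"
  by (metis Cinf_neg apply_Cinf_inject ext not_le)

lemma Cinf_bdd: "bdd_above ((\<lambda>t. norm (apply_Cinf f t)) ` {0..})"
proof -
  have "\<forall>\<^sub>F t in at_top. norm (apply_Cinf f t) < 1"
    using tendsto_norm[OF Cinf_tendsto[of f]] by (intro order_tendstoD) auto
  then obtain N where N: "\<And>t. t \<ge> N \<Longrightarrow> norm (apply_Cinf f t) < 1"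
    by (auto simp: eventually_at_top_linorder)
  have "compact ((\<lambda>t. norm (apply_Cinf f t)) ` {0..max 0 N})"
    by (intro compact_continuous_image continuous_intros
        continuous_on_subset[OF Cinf_continuous[of f]]) auto
  then obtain B where B: "\<And>t. 0 \<le> t \<Longrightarrow> t \<le> max 0 N \<Longrightarrow> norm (apply_Cinf f t) \<le> B"
    by (force dest!: compact_imp_bounded bounded_imp_bdd_above simp: bdd_above_def)
  have "norm (apply_Cinf f t) \<le> max B 1" if "t \<ge> 0" for t
  proof (cases "t \<le> max 0 N")
    case True
    then show ?thesis using B[OF that] by (simp add: le_max_iff_disj)
  next
    case False
    then show ?thesis using N[of t] by (simp add: le_max_iff_disj)
  qed
  then show ?thesis
    by (auto intro!: bdd_aboveI[of _ "max B 1"])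
qed

instantiation Cinf :: (real_normed_field) real_normed_vector
begin

lift_definition zero_Cinf :: "'a Cinf" is "\<lambda>_. 0" by auto

lift_definition plus_Cinf :: "'a Cinf \<Rightarrow> 'a Cinf \<Rightarrow> 'a Cinf" is "\<lambda>f g t. f t + g t"
  by (auto intro!: continuous_intros tendsto_add_zero)

lift_definition minus_Cinf :: "'a Cinf \<Rightarrow> 'a Cinf \<Rightarrow> 'a Cinf" is "\<lambda>f g t. f t - g t"
  by (auto intro!: continuous_intros tendsto_eq_intros)

lift_definition uminus_Cinf :: "'a Cinf \<Rightarrow> 'a Cinf" is "\<lambda>f t. - f t"
  by (auto intro!: continuous_intros tendsto_eq_intros)

lift_definition scaleR_Cinf :: "real \<Rightarrow> 'a Cinf \<Rightarrow> 'a Cinf" is "\<lambda>c f t. c *\<^sub>R f t"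
  by (auto intro!: continuous_intros tendsto_eq_intros)

definition norm_Cinf :: "'a Cinf \<Rightarrow> real" where
  "norm_Cinf f = (SUP t\<in>{0..}. norm (apply_Cinf f t))"

definition dist_Cinf :: "'a Cinf \<Rightarrow> 'a Cinf \<Rightarrow> real" where
  "dist_Cinf f g = norm (f - g)"

definition sgn_Cinf :: "'a Cinf \<Rightarrow> 'a Cinf" where
  "sgn_Cinf f = inverse (norm f) *\<^sub>R f"

definition uniformity_Cinf :: "('a Cinf \<times> 'a Cinf) filter" where
  "uniformity_Cinf = (INF e\<in>{0<..}. principal {(x, y). dist x y < e})"

definition open_Cinf :: "'a Cinf set \<Rightarrow> bool" where
  "open_Cinf U \<longleftrightarrow> (\<forall>x\<in>U. \<forall>\<^sub>F (x', y) in uniformity. x' = x \<longrightarrow> y \<in> U)"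

lemma norm_Cinf_upper: "t \<ge> 0 \<Longrightarrow> norm (apply_Cinf f t) \<le> norm f"
  unfolding norm_Cinf_def by (rule cSUP_upper[OF _ Cinf_bdd]) auto

lemma norm_Cinf_least: "(\<And>t. t \<ge> 0 \<Longrightarrow> norm (apply_Cinf f t) \<le> B) \<Longrightarrow> norm f \<le> B"
  unfolding norm_Cinf_def by (rule cSUP_least) auto

lemma norm_Cinf_nonneg: "0 \<le> norm (f :: 'a Cinf)"
  using norm_Cinf_upper[of 0 f] norm_ge_zero order_trans by blast

instance
proof
  fix f g h :: "'a Cinf" and a b :: real
  show "f + g + h = f + (g + h)" by transfer (auto simp: add_ac)
  show "f + g = g + f" by transfer (auto simp: add_ac)
  show "0 + f = f" by transfer auto
  show "- f + f = 0" by transfer auto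
  show "f - g = f + - g" by transfer auto
  show "a *\<^sub>R (f + g) = a *\<^sub>R f + a *\<^sub>R g" by transfer (auto simp: algebra_simps)
  show "(a + b) *\<^sub>R f = a *\<^sub>R f + b *\<^sub>R f" by transfer (auto simp: algebra_simps)
  show "a *\<^sub>R b *\<^sub>R f = (a * b) *\<^sub>R f" by transfer auto
  show "1 *\<^sub>R f = f" by transfer auto
  show "dist f g = norm (f - g)" by (rule dist_Cinf_def)
  show "sgn f = inverse (norm f) *\<^sub>R f" by (rule sgn_Cinf_def)
  show "uniformity = (INF e\<in>{0<..}. principal {(x, y :: 'a Cinf). dist x y < e})"
    by (rule uniformity_Cinf_def)
  show "open U \<longleftrightarrow> (\<forall>x\<in>U. \<forall>\<^sub>F (x', y) in uniformity. x' = x \<longrightarrow> y \<in> U)" for U :: "'a Cinf set"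
    by (rule open_Cinf_def)
  show "norm f = 0 \<longleftrightarrow> f = 0"
  proof
    assume "norm f = 0"
    then show "f = 0"
      using norm_Cinf_upper[of _ f] by (intro Cinf_eqI) (simp add: zero_Cinf.rep_eq)
  next
    assume "f = 0"
    then have "norm f \<le> 0"
      by (intro norm_Cinf_least) (simp add: zero_Cinf.rep_eq)
    then show "norm f = 0" using norm_Cinf_nonneg[of f] by simp
  qed
  show "norm (f + g) \<le> norm f + norm g"
    by (rule norm_Cinf_least)
      (auto simp: plus_Cinf.rep_eq intro!: norm_triangle_le add_mono norm_Cinf_upper)
  show "norm (a *\<^sub>R f) = \<bar>a\<bar> * norm f"
  proof (cases "a = 0")
    case True
    have "norm (a *\<^sub>R f) \<le> 0"
      by (rule norm_Cinf_least) (simp add: True scaleR_Cinf.rep_eq)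
    then show ?thesis using norm_Cinf_nonneg[of "a *\<^sub>R f"] True by simp
  next
    case False
    have 1: "norm (a *\<^sub>R f) \<le> \<bar>a\<bar> * norm f"
      by (rule norm_Cinf_least)
        (auto simp: scaleR_Cinf.rep_eq intro!: mult_left_mono norm_Cinf_upper)
    have "norm f \<le> norm (a *\<^sub>R f) / \<bar>a\<bar>"
    proof (rule norm_Cinf_least)
      fix t :: real assume "t \<ge> 0"
      from norm_Cinf_upper[OF this, of "a *\<^sub>R f"]
      show "norm (apply_Cinf f t) \<le> norm (a *\<^sub>R f) / \<bar>a\<bar>"
        using False by (simp add: scaleR_Cinf.rep_eq field_simps)
    qed
    then show ?thesis using 1 False by (simp add: field_simps)
  qed
qed

end

instance Cinf :: ("{real_normed_field,banach}") banach
proof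
  fix X :: "nat \<Rightarrow> 'a Cinf" assume X: "Cauchy X"
  define F where "F = (\<lambda>n. apply_Cinf (X n))"
  have "uniformly_Cauchy_on {0..} F"
  proof (rule uniformly_Cauchy_onI)
    fix e :: real assume "e > 0"
    then obtain M where M: "\<And>m n. m \<ge> M \<Longrightarrow> n \<ge> M \<Longrightarrow> norm (X m - X n) < e"
      using X unfolding Cauchy_def dist_norm by meson
    show "\<exists>M. \<forall>x\<in>{0..}. \<forall>m\<ge>M. \<forall>n\<ge>M. dist (F m x) (F n x) < e"
    proof (intro exI[of _ M] ballI allI impI)
      fix x :: real and m n assume *: "x \<in> {0..}" "m \<ge> M" "n \<ge> M"
      have "dist (F m x) (F n x) = norm (apply_Cinf (X m - X n) x)"
        by (simp add: F_def dist_norm minus_Cinf.rep_eq)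
      also have "\<dots> \<le> norm (X m - X n)" using * by (intro norm_Cinf_upper) auto
      finally show "dist (F m x) (F n x) < e" using M[of m n] * by simp
    qed
  qed
  then obtain l where l: "uniform_limit {0..} F l sequentially"
    using Cauchy_uniformly_convergent uniformly_convergent_on_def by blast
  define L where "L = (\<lambda>t. if t < 0 then 0 else l t)"
  have UL: "uniform_limit {0..} F L sequentially"
    using l by (rule uniform_limit_cong'[THEN iffD1, rotated -1]) (auto simp: L_def)
  have cont: "continuous_on {0..} L"
    by (rule uniform_limit_theorem[OF _ UL]) (auto simp: F_def Cinf_continuous)
  have lim: "(L \<longlongrightarrow> 0) at_top"
  proof (rule tendstoI)
    fix e :: real assume "e > 0"
    then have "\<forall>\<^sub>F n in sequentially. \<forall>t\<in>{0..}. dist (F n t) (L t) < e / 2"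
      using UL by (intro uniform_limitD) auto
    then obtain n where n: "\<And>t. t \<ge> 0 \<Longrightarrow> dist (F n t) (L t) < e / 2"
      by (auto simp: eventually_sequentially)
    have "\<forall>\<^sub>F t in at_top. dist (F n t) 0 < e / 2"
      using \<open>e > 0\<close> Cinf_tendsto[of "X n"] by (intro tendstoD) (auto simp: F_def)
    moreover have "\<forall>\<^sub>F t :: real in at_top. t \<ge> 0" by (rule eventually_ge_at_top)
    ultimately show "\<forall>\<^sub>F t in at_top. dist (L t) 0 < e"
      by eventually_elim (use n dist_triangle_half_r in blast)
  qed
  have L: "apply_Cinf (Cinf L) = L"
    using cont lim by (intro Cinf_inverse) (auto simp: L_def)
  have "X \<longlonglongrightarrow> Cinf L"
  proof (rule tendstoI)
    fix e :: real assume "e > 0"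
    then have "\<forall>\<^sub>F n in sequentially. \<forall>t\<in>{0..}. dist (F n t) (L t) < e / 2"
      using UL by (intro uniform_limitD) auto
    then show "\<forall>\<^sub>F n in sequentially. dist (X n) (Cinf L) < e"
    proof eventually_elim
      case (elim n)
      have "norm (X n - Cinf L) \<le> e / 2"
        by (rule norm_Cinf_least)
          (use elim in \<open>auto simp: minus_Cinf.rep_eq L F_def dist_norm less_imp_le\<close>)
      then show ?case using \<open>e > 0\<close> by (simp add: dist_norm)
    qed
  qed
  then show "convergent X" by (auto simp: convergent_def)
qed

text \<open>
  Multiplication by scalars from \<open>'k\<close>; linear spans have to be taken with respect to it, since for
  \<open>'k = complex\<close> the type-class span would only allow real coefficients.
\<close>

lift_definition scale_Cinf :: "'k::real_normed_field \<Rightarrow> 'k Cinf \<Rightarrow> 'k Cinf" is "\<lambda>c f t. c * f t"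
  by (auto intro!: continuous_intros tendsto_mult_right_zero)

global_interpretation Cinf: vector_space "scale_Cinf :: 'k::real_normed_field \<Rightarrow> _"
  defines span_Cinf = Cinf.span and subspace_Cinf = Cinf.subspace
  by standard (transfer; auto simp: algebra_simps)+

lift_definition exp_Cinf :: "real \<Rightarrow> 'k::real_normed_field Cinf" is
  "\<lambda>a t. if a > 0 \<and> t \<ge> 0 then of_real (exp (- a * t)) else 0"
proof -
  fix a :: real
  let ?f = "\<lambda>t. if a > 0 \<and> t \<ge> 0 then of_real (exp (- a * t)) else (0::'k)"
  show "continuous_on {0..} ?f \<and> (?f \<longlongrightarrow> 0) at_top \<and> (\<forall>t<0. ?f t = 0)"
  proof (cases "a > 0")
    case True
    have "continuous_on {0..} (\<lambda>t. of_real (exp (- a * t)) :: 'k)"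
      by (intro continuous_intros)
    then have "continuous_on {0..} ?f"
      by (rule continuous_on_eq) (use True in auto)
    moreover have "(?f \<longlongrightarrow> 0) at_top"
    proof (rule Lim_transform_eventually)
      have "filterlim (\<lambda>t. - a * t) at_bot at_top"
        by (rule filterlim_tendsto_neg_mult_at_bot[OF tendsto_const _ filterlim_ident])
          (use True in simp)
      then have *: "((\<lambda>t. exp (- a * t)) \<longlongrightarrow> 0) at_top"
        by (rule filterlim_compose[OF exp_at_bot])
      show "((\<lambda>t. of_real (exp (- a * t)) :: 'k) \<longlongrightarrow> 0) at_top"
        using tendsto_of_real[OF *, where 'a = 'k] unfolding of_real_0 .
      show "\<forall>\<^sub>F t in at_top. of_real (exp (- a * t)) = ?f t"
        using eventually_ge_at_top[of 0] by eventually_elim (use True in simp)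
    qed
    ultimately show ?thesis by auto
  qed auto
qed

lemma exp_Cinf_apply:
  "a > 0 \<Longrightarrow> t \<ge> 0 \<Longrightarrow> apply_Cinf (exp_Cinf a) t = of_real (exp (- a * t))"
  by (simp add: exp_Cinf.rep_eq)

definition I_upto :: "enat \<Rightarrow> nat set" where
  "I_upto n = {k. 1 \<le> k \<and> enat k \<le> n}"

definition Exp :: "(nat \<Rightarrow> real) \<Rightarrow> enat \<Rightarrow> 'k::real_normed_field Cinf set" where
  "Exp \<alpha> n = closure (span_Cinf ((\<lambda>k. exp_Cinf (\<alpha> k)) ` I_upto n))"

definition gap_condition :: "real \<Rightarrow> (nat \<Rightarrow> real) \<Rightarrow> enat \<Rightarrow> bool" where
  "gap_condition \<Delta> \<alpha> n \<longleftrightarrow>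
     (\<forall>k. k \<in> I_upto n \<and> k + 1 \<in> I_upto n \<longrightarrow> \<alpha> (k + 1) - \<alpha> k \<ge> \<Delta>)"

text \<open>The value is \<open>\<infinity>\<close> if the series of reciprocals diverges.\<close>

definition reciprocal_sum :: "(nat \<Rightarrow> real) \<Rightarrow> enat \<Rightarrow> ennreal" where
  "reciprocal_sum \<alpha> n = (\<Sum>\<^sub>\<infinity>k\<in>I_upto n. ennreal (1 / \<alpha> k))"

text \<open>
  The standing assumption that the members of the family are closed linear subspaces is not part of
  the predicate, so that its negation really refutes the representation property; for the spaces
  \<open>Exp \<alpha> n\<close> it is established in \<open>closed_Exp\<close> and \<open>subspace_Exp\<close>.
\<close>

definition ARFS :: "'i set \<Rightarrow> ('i \<Rightarrow> 'x::banach set) \<Rightarrow> bool" where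
  "ARFS \<Lambda> X \<longleftrightarrow>
     (\<forall>x. \<exists>y. (\<forall>l\<in>\<Lambda>. y l \<in> X l) \<and> (\<lambda>l. norm (y l)) summable_on \<Lambda> \<and> (y has_sum x) \<Lambda>)"

lemma closed_Exp: "closed (Exp \<alpha> n)"
  by (simp add: Exp_def)

lemma norm_scale_Cinf_le: "norm (scale_Cinf c f) \<le> norm c * norm f"
  by (rule norm_Cinf_least)
    (auto simp: scale_Cinf.rep_eq norm_mult intro!: mult_left_mono norm_Cinf_upper)

lemma subspace_Exp: "subspace_Cinf (Exp \<alpha> n :: 'k::real_normed_field Cinf set)"
proof -
  define S :: "'k Cinf set" where "S = span_Cinf ((\<lambda>k. exp_Cinf (\<alpha> k)) ` I_upto n)"
  have sub: "subspace_Cinf S" unfolding S_def by (rule Cinf.subspace_span)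
  have Exp: "x \<in> Exp \<alpha> n \<longleftrightarrow> (\<exists>f. (\<forall>i. f i \<in> S) \<and> f \<longlonglongrightarrow> x)" for x
    unfolding Exp_def S_def by (rule closure_sequential)
  show ?thesis
  proof (rule Cinf.subspaceI)
    show "(0 :: 'k Cinf) \<in> Exp \<alpha> n"
      unfolding Exp using Cinf.subspace_0[OF sub] by (intro exI[of _ "\<lambda>_. 0"]) simp
  next
    fix x y :: "'k Cinf" assume "x \<in> Exp \<alpha> n" "y \<in> Exp \<alpha> n"
    then obtain f g where fg: "\<forall>i. f i \<in> S" "f \<longlonglongrightarrow> x" "\<forall>i. g i \<in> S" "g \<longlonglongrightarrow> y"
      unfolding Exp by (elim exE conjE)
    have "(\<lambda>i. f i + g i) \<longlonglongrightarrow> x + y"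
      using fg(2,4) by (rule tendsto_add)
    moreover have "\<forall>i. f i + g i \<in> S"
      using fg(1,3) Cinf.subspace_add[OF sub] by simp
    ultimately show "x + y \<in> Exp \<alpha> n"
      unfolding Exp by (intro exI conjI)
  next
    fix c :: 'k and x :: "'k Cinf" assume "x \<in> Exp \<alpha> n"
    then obtain f where f: "\<forall>i. f i \<in> S" "f \<longlonglongrightarrow> x"
      unfolding Exp by (elim exE conjE)
    have "bounded_linear (scale_Cinf c)"
    proof (rule bounded_linear_intro[where K = "norm c"])
      show "scale_Cinf c (r *\<^sub>R x) = r *\<^sub>R scale_Cinf c x" for r x
        by (rule Cinf_eqI) (simp add: scale_Cinf.rep_eq scaleR_Cinf.rep_eq)
      show "norm (scale_Cinf c x) \<le> norm x * norm c" for x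
        using norm_scale_Cinf_le[of c x] by (simp add: mult.commute)
    qed (rule Cinf.scale_right_distrib)
    then have "(\<lambda>i. scale_Cinf c (f i)) \<longlonglongrightarrow> scale_Cinf c x"
      using f(2) by (rule bounded_linear.tendsto)
    moreover have "\<forall>i. scale_Cinf c (f i) \<in> S"
      using f(1) Cinf.subspace_scale[OF sub] by simp
    ultimately show "scale_Cinf c x \<in> Exp \<alpha> n"
      unfolding Exp by (intro exI conjI)
  qed
qed

end

theory Submission
  imports Defs
begin

text \<open>
  The functions in all the \<open>X\<^sub>\<lambda>\<close> are Lipschitz on one common half line \<open>[T,\<infinity>)\<close> with constant
  \<open>L \<parallel>f\<parallel>\<close>, where \<open>T\<close> and \<open>L\<close> depend only on \<open>\<Delta>\<close> and \<open>C\<close>. Absolutely convergent sums inherit this, so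
  a function with a square-root cusp beyond \<open>T\<close> is not representable.

  For an exponential sum \<open>f\<close> the Lipschitz bound follows from \<open>\<bar>c\<^sub>k\<bar> \<le> \<parallel>f\<parallel> e\<^bsup>K (\<alpha>\<^sub>k + 1)\<^esup>\<close>. Here the \<open>L\<^sup>2\<close> norm
  of \<open>e\<^bsup>-t\<^esup> f(t)\<close> is a quadratic form in the coefficients that does not increase under the all-pass filters
  \<open>e\<^bsup>-at\<^esup> \<mapsto> (a - b)/(a + b) e\<^bsup>-at\<^esup>\<close>; applying them for all exponents \<open>b\<close> but one isolates a single
  coefficient. The resulting product of \<open>(a + b)/\<bar>a - b\<bar>\<close> is at most exponential in \<open>a\<close>: the gap
  condition controls the factors with \<open>b < 2a\<close>, and the sum of reciprocals the others.
\<close>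

section \<open>Gram form of exponentials and all-pass filters\<close>

text \<open>The squared norm of \<open>\<Sum>a\<in>A. c a * exp (- a * t)\<close> in \<open>L\<^sup>2(0,\<infinity>)\<close>.\<close>

definition exp_gram :: "real set \<Rightarrow> (real \<Rightarrow> real) \<Rightarrow> real" where
  "exp_gram A c = (\<Sum>a\<in>A. \<Sum>b\<in>A. c a * c b / (a + b))"

text \<open>The numerator of \<open>1 - (x - b) * (y - b) / ((x + b) * (y + b))\<close> is
  \<open>2 * b * (x + y)\<close>, which cancels the denominator \<open>x + y\<close> of the kernel.
  The loss is therefore a rank-one form, a nonnegative multiple of a square.\<close>

lemma exp_gram_contract:
  assumes "\<And>a. a \<in> A \<Longrightarrow> a > 0" and "b > 0"
  shows "exp_gram A (\<lambda>a. c a * ((a - b) / (a + b))) \<le> exp_gram A c"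
proof -
  have "exp_gram A c - exp_gram A (\<lambda>a. c a * ((a - b) / (a + b))) =
      (\<Sum>x\<in>A. \<Sum>y\<in>A. 2 * b * ((c x / (x + b)) * (c y / (y + b))))"
    unfolding exp_gram_def sum_subtractf[symmetric]
  proof (intro sum.cong refl)
    fix x y assume "x \<in> A" "y \<in> A"
    then have "x > 0" "y > 0" using assms by auto
    then have nz: "x + y \<noteq> 0" "x + b \<noteq> 0" "y + b \<noteq> 0" using \<open>b > 0\<close> by auto
    have "(c x * c y) / (x + y) - (c x * ((x - b) / (x + b))) * (c y * ((y - b) / (y + b))) / (x + y)
        = c x * c y * ((x + b) * (y + b) - (x - b) * (y - b)) / ((x + y) * (x + b) * (y + b))"
      using nz by (simp add: divide_simps) (simp add: algebra_simps)
    also have "(x + b) * (y + b) - (x - b) * (y - b) = 2 * b * (x + y)"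
      by (simp add: algebra_simps)
    also have "c x * c y * (2 * b * (x + y)) / ((x + y) * (x + b) * (y + b))
        = 2 * b * ((c x / (x + b)) * (c y / (y + b)))"
      using nz by (simp add: divide_simps)
    finally show "c x * c y / (x + y) - (c x * ((x - b) / (x + b))) * (c y * ((y - b) / (y + b))) / (x + y)
        = 2 * b * ((c x / (x + b)) * (c y / (y + b)))" .
  qed
  also have "\<dots> = 2 * b * (\<Sum>x\<in>A. c x / (x + b))\<^sup>2"
    unfolding power2_eq_square sum_product by (simp only: sum_distrib_left)
  also have "\<dots> \<ge> 0" using \<open>b > 0\<close> by simp
  finally show ?thesis by simp
qed

lemma exp_gram_contract_prod:
  assumes "finite B" and "\<And>a. a \<in> A \<Longrightarrow> a > 0" and "\<And>b. b \<in> B \<Longrightarrow> b > 0"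
  shows "exp_gram A (\<lambda>a. c a * (\<Prod>b\<in>B. (a - b) / (a + b))) \<le> exp_gram A c"
  using assms(1,3)
proof (induction B rule: finite_induct)
  case (insert b B)
  have "exp_gram A (\<lambda>a. c a * (\<Prod>b\<in>insert b B. (a - b) / (a + b)))
      = exp_gram A (\<lambda>a. (c a * (\<Prod>b\<in>B. (a - b) / (a + b))) * ((a - b) / (a + b)))"
    using insert by (simp add: mult_ac)
  also have "\<dots> \<le> exp_gram A (\<lambda>a. c a * (\<Prod>b\<in>B. (a - b) / (a + b)))"
    using assms(2) insert.prems by (intro exp_gram_contract) auto
  also have "\<dots> \<le> exp_gram A c" using insert by auto
  finally show ?case .
qed simp

text \<open>The filters for all \<open>b\<close> in \<open>A - {x}\<close> together annihilate every
  coefficient except the one at \<open>x\<close>, so only one diagonal term of the double sum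
  survives.\<close>

lemma exp_gram_coefficient_le:
  assumes "finite A" "x \<in> A" and pos: "\<And>a. a \<in> A \<Longrightarrow> a > 0"
  shows "(c x * (\<Prod>b\<in>A - {x}. (x - b) / (x + b)))\<^sup>2 / (2 * x) \<le> exp_gram A c"
proof -
  define d where "d = (\<lambda>a. c a * (\<Prod>b\<in>A - {x}. (a - b) / (a + b)))"
  have "d a = 0" if "a \<in> A" "a \<noteq> x" for a
    using that assms(1) by (auto simp: d_def)
  then have "exp_gram A d = (\<Sum>a\<in>A. if a = x then (\<Sum>b\<in>A. if b = x then d x * d x / (x + x) else 0) else 0)"
    unfolding exp_gram_def by (intro sum.cong) (auto intro!: sum.cong)
  also have "\<dots> = (d x)\<^sup>2 / (2 * x)" using assms by (simp add: power2_eq_square)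
  finally have "(d x)\<^sup>2 / (2 * x) = exp_gram A d" by simp
  also have "\<dots> \<le> exp_gram A c"
    unfolding d_def using assms by (intro exp_gram_contract_prod) auto
  finally show ?thesis by (simp add: d_def)
qed

text \<open>Expanding the square produces the kernel \<open>exp (- (a + b) * t)\<close>, whose
  integral is \<open>1 / (a + b)\<close>. The hypothesis contains the factor
  \<open>exp (- t)\<close> because a mere sup bound gives no square-integrable majorant on the half
  line.\<close>

lemma exp_gram_le:
  assumes "finite A" and pos: "\<And>a. a \<in> A \<Longrightarrow> a > 0"
    and bound: "\<And>t. t \<ge> 0 \<Longrightarrow> \<bar>\<Sum>a\<in>A. c a * exp (- a * t)\<bar> \<le> M * exp (- t)"
  shows "exp_gram A c \<le> M\<^sup>2 / 2"
proof (rule has_integral_le)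
  show "((\<lambda>t. \<Sum>a\<in>A. \<Sum>b\<in>A. c a * c b * exp (- (a + b) * t)) has_integral exp_gram A c) {0..}"
    unfolding exp_gram_def
  proof (intro has_integral_sum assms)
    fix a b assume "a \<in> A" "b \<in> A"
    then have "a + b > 0" using pos by (simp add: add_pos_pos)
    from has_integral_mult_right[OF has_integral_exp_minus_to_infinity[OF this, of 0], of "c a * c b"]
    show "((\<lambda>t. c a * c b * exp (- (a + b) * t)) has_integral c a * c b / (a + b)) {0..}"
      by simp
  qed
  show "((\<lambda>t. M\<^sup>2 * exp (- 2 * t)) has_integral M\<^sup>2 / 2) {0..}"
    using has_integral_mult_right[OF has_integral_exp_minus_to_infinity[of 2 0], of "M\<^sup>2"] by simp
  fix t :: real assume "t \<in> {0..}"
  then have "\<bar>\<Sum>a\<in>A. c a * exp (- a * t)\<bar>\<^sup>2 \<le> (M * exp (- t))\<^sup>2"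
    by (intro power_mono bound) auto
  moreover have "(M * exp (- t))\<^sup>2 = M\<^sup>2 * exp (- 2 * t)"
    by (simp add: power_mult_distrib power2_eq_square flip: exp_add)
  moreover have "(\<Sum>a\<in>A. c a * exp (- a * t))\<^sup>2 = (\<Sum>a\<in>A. \<Sum>b\<in>A. c a * c b * exp (- (a + b) * t))"
    unfolding power2_eq_square sum_product
    by (intro sum.cong refl) (simp add: ring_distribs exp_add mult_ac exp_diff exp_minus field_simps)
  ultimately show "(\<Sum>a\<in>A. \<Sum>b\<in>A. c a * c b * exp (- (a + b) * t)) \<le> M\<^sup>2 * exp (- 2 * t)"
    by simp
qed

section \<open>Products over separated exponents\<close>

lemma separated_prod_ge:
  fixes S :: "real set"
  assumes "finite S" and "\<Delta> > 0" and "\<And>x. x \<in> S \<Longrightarrow> x \<ge> \<Delta>"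
    and "\<And>x y. x \<in> S \<Longrightarrow> y \<in> S \<Longrightarrow> x < y \<Longrightarrow> y - x \<ge> \<Delta>"
  shows "\<Delta> ^ card S * fact (card S) \<le> \<Prod>S"
proof -
  \<comment> \<open>In increasing order the i-th point is at least i times \<Delta>. The second
    conjunct carries this through the induction: it is applied to the point \<open>b\<close> added
    next, which lies above all of \<open>S\<close>.\<close>
  have "\<Delta> ^ card S * fact (card S) \<le> \<Prod>S \<and>
      (\<forall>u. u \<ge> \<Delta> \<longrightarrow> (\<forall>x\<in>S. u - x \<ge> \<Delta>) \<longrightarrow> u \<ge> real (Suc (card S)) * \<Delta>)"
    using assms(1,3,4)
  proof (induction S rule: finite_linorder_max_induct)
    case empty
    then show ?case by simp
  next
    case (insert b S)
    have b: "b \<notin> S" using insert.hyps by auto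
    have IH: "\<Delta> ^ card S * fact (card S) \<le> \<Prod>S"
       "\<And>u. u \<ge> \<Delta> \<Longrightarrow> (\<forall>x\<in>S. u - x \<ge> \<Delta>) \<Longrightarrow> u \<ge> real (Suc (card S)) * \<Delta>"
      using insert.IH insert.prems by auto
    have bS: "b \<ge> real (Suc (card S)) * \<Delta>"
      using insert.hyps insert.prems by (intro IH(2)) auto
    have "(real (Suc (card S)) * \<Delta>) * (\<Delta> ^ card S * fact (card S)) \<le> b * \<Prod>S"
      using bS IH(1) \<open>\<Delta> > 0\<close> insert.prems(1)[of b]
      by (intro mult_mono) auto
    then have 1: "\<Delta> ^ card (insert b S) * fact (card (insert b S)) \<le> \<Prod>(insert b S)"
      using insert.hyps b by (simp add: algebra_simps)
    have "u \<ge> real (Suc (card (insert b S))) * \<Delta>" if "\<forall>x\<in>insert b S. u - x \<ge> \<Delta>" for u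
      using that bS insert.hyps b by (simp add: algebra_simps)
    with 1 show ?case by blast
  qed
  then show ?thesis by blast
qed

text \<open>The factorial bound leaves a single term of the exponential series at
  \<open>z / \<Delta>\<close>, so the estimate is independent of the number of points.\<close>

lemma power_div_prod_separated_le:
  fixes S :: "real set"
  assumes "finite S" "\<Delta> > 0" "z \<ge> 0" "\<And>x. x \<in> S \<Longrightarrow> x \<ge> \<Delta>"
    and "\<And>x y. x \<in> S \<Longrightarrow> y \<in> S \<Longrightarrow> x < y \<Longrightarrow> y - x \<ge> \<Delta>"
  shows "(\<Prod>x\<in>S. z / x) \<le> exp (z / \<Delta>)"
proof -
  have "(\<Prod>x\<in>S. z / x) = z ^ card S / \<Prod>S"
    by (simp add: prod_dividef)
  also have "\<dots> \<le> z ^ card S / (\<Delta> ^ card S * fact (card S))"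
    using assms separated_prod_ge[OF assms(1,2,4,5)] by (intro divide_left_mono) (auto intro!: mult_pos_pos prod_pos, fastforce)
  also have "\<dots> = (z / \<Delta>) ^ card S / fact (card S)"
    by (simp add: power_divide)
  also have "\<dots> \<le> exp (z / \<Delta>)"
  proof -
    have "(\<Sum>k\<in>{card S}. inverse (fact k) * (z / \<Delta>) ^ k) \<le> (\<Sum>k. inverse (fact k) * (z / \<Delta>) ^ k)"
      using assms(2,3) by (intro sum_le_suminf summable_exp) auto
    then show ?thesis by (simp add: exp_def field_simps)
  qed
  finally show ?thesis .
qed

lemma blaschke_prod_le:
  fixes A :: "real set"
  assumes "finite A" "x \<in> A" "\<Delta> > 0" and pos: "\<And>a. a \<in> A \<Longrightarrow> a > 0"
    and gap: "\<And>a b. a \<in> A \<Longrightarrow> b \<in> A \<Longrightarrow> a < b \<Longrightarrow> b - a \<ge> \<Delta>"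
    and C: "(\<Sum>a\<in>A. 1 / a) \<le> C"
  shows "(\<Prod>b\<in>A - {x}. (x + b) / \<bar>x - b\<bar>) \<le> exp ((5 / \<Delta> + 4 * C) * x)"
proof -
  define L where "L = {b\<in>A. b < x}"
  define U where "U = {b\<in>A. x < b \<and> b < 2 * x}"
  define F where "F = {b\<in>A. 2 * x \<le> b}"
  have x: "x > 0" using assms by auto
  have split: "A - {x} = L \<union> (U \<union> F)"
    using x assms(2) by (auto simp: L_def U_def F_def)
  have fin: "finite L" "finite U" "finite F"
    using assms(1) by (auto simp: L_def U_def F_def)
  \<comment> \<open>Below \<open>x\<close> the numerator is at most \<open>2 * x\<close>, and the
    distances \<open>x - b\<close> are again separated points, each at least \<Delta>.\<close>
  have "(\<Prod>b\<in>L. (x + b) / \<bar>x - b\<bar>) \<le> (\<Prod>b\<in>L. (2 * x) / (x - b))"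
    by (intro prod_mono) (use pos in \<open>auto simp: L_def intro!: divide_right_mono divide_nonneg_nonneg dest: pos\<close>)
  also have "\<dots> = (\<Prod>y\<in>(\<lambda>b. x - b) ` L. (2 * x) / y)"
    by (subst prod.reindex) (auto simp: inj_on_def)
  also have "\<dots> \<le> exp (2 * x / \<Delta>)"
    using fin x assms(3) gap[OF _ \<open>x \<in> A\<close>] gap
    by (intro power_div_prod_separated_le) (auto simp: L_def)
  finally have 1: "(\<Prod>b\<in>L. (x + b) / \<bar>x - b\<bar>) \<le> exp (2 * x / \<Delta>)" .
  \<comment> \<open>Between \<open>x\<close> and \<open>2 * x\<close> the numerator is at most
    \<open>3 * x\<close>; with the 2 from \<open>L\<close> this makes the 5 in the final
    exponent.\<close>
  have "(\<Prod>b\<in>U. (x + b) / \<bar>x - b\<bar>) \<le> (\<Prod>b\<in>U. (3 * x) / (b - x))"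
    by (intro prod_mono) (use x in \<open>auto simp: U_def intro!: divide_right_mono divide_nonneg_nonneg\<close>)
  also have "\<dots> = (\<Prod>y\<in>(\<lambda>b. b - x) ` U. (3 * x) / y)"
    by (subst prod.reindex) (auto simp: inj_on_def)
  also have "\<dots> \<le> exp (3 * x / \<Delta>)"
    using fin x assms(3) gap[OF \<open>x \<in> A\<close>] gap
    by (intro power_div_prod_separated_le) (auto simp: U_def)
  finally have 2: "(\<Prod>b\<in>U. (x + b) / \<bar>x - b\<bar>) \<le> exp (3 * x / \<Delta>)" .
  have "(\<Prod>b\<in>F. (x + b) / \<bar>x - b\<bar>) \<le> (\<Prod>b\<in>F. exp (4 * x / b))"
  proof (intro prod_mono conjI)
    fix b assume "b \<in> F"
    then have b: "2 * x \<le> b" by (simp add: F_def)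
    then show "0 \<le> (x + b) / \<bar>x - b\<bar>" using x by simp
    have "(x + b) / \<bar>x - b\<bar> \<le> 1 + 4 * x / b"
    proof -
      \<comment> \<open>After clearing denominators the two sides differ by
        \<open>2 * x * (b - 2 * x)\<close>, which is nonnegative on \<open>F\<close>.\<close>
      have "x * b * 2 \<ge> x * (2 * x) * 2" using x b by (intro mult_right_mono mult_left_mono) auto
      then have "(x + b) * b \<le> (b + 4 * x) * (b - x)"
        by (simp add: algebra_simps)
      then show ?thesis using x b by (simp add: field_simps)
    qed
    also have "\<dots> \<le> exp (4 * x / b)" by (rule exp_ge_add_one_self)
    finally show "(x + b) / \<bar>x - b\<bar> \<le> exp (4 * x / b)" .
  qed
  also have "\<dots> = exp (4 * x * (\<Sum>b\<in>F. 1 / b))"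
    using fin by (simp add: exp_sum sum_distrib_left)
  also have "\<dots> \<le> exp (4 * x * C)"
  proof -
    have "(\<Sum>b\<in>F. 1 / b) \<le> (\<Sum>a\<in>A. 1 / a)"
      using assms by (intro sum_mono2) (auto simp: F_def less_imp_le)
    then show ?thesis using C x by simp
  qed
  finally have 3: "(\<Prod>b\<in>F. (x + b) / \<bar>x - b\<bar>) \<le> exp (4 * x * C)" .
  have nn: "0 \<le> (\<Prod>b\<in>B. (x + b) / \<bar>x - b\<bar>)" if "B \<subseteq> A" for B
    using that pos x
    by (intro prod_nonneg) (force intro!: divide_nonneg_nonneg add_nonneg_nonneg intro: less_imp_le)
  have "(\<Prod>b\<in>A - {x}. (x + b) / \<bar>x - b\<bar>) =
      (\<Prod>b\<in>L. (x + b) / \<bar>x - b\<bar>) * ((\<Prod>b\<in>U. (x + b) / \<bar>x - b\<bar>) * (\<Prod>b\<in>F. (x + b) / \<bar>x - b\<bar>))"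
    unfolding split using fin x
    by (subst prod.union_disjoint; (subst prod.union_disjoint)?) (auto simp: L_def U_def F_def)
  also have "\<dots> \<le> exp (2 * x / \<Delta>) * (exp (3 * x / \<Delta>) * exp (4 * x * C))"
    by (intro mult_mono 1 2 3 nn mult_nonneg_nonneg) (auto simp: L_def U_def F_def)
  also have "\<dots> = exp ((5 / \<Delta> + 4 * C) * x)"
    by (simp add: algebra_simps add_divide_distrib flip: exp_add)
  finally show ?thesis .
qed

section \<open>Coefficient and Lipschitz bounds for finite exponential sums\<close>

lemma exp_sum_coefficient_le:
  fixes A :: "real set"
  assumes "finite A" "x \<in> A" "\<Delta> > 0" and pos: "\<And>a. a \<in> A \<Longrightarrow> a > 0"
    and gap: "\<And>a b. a \<in> A \<Longrightarrow> b \<in> A \<Longrightarrow> a < b \<Longrightarrow> b - a \<ge> \<Delta>"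
    and C: "(\<Sum>a\<in>A. 1 / a) \<le> C"
    and bound: "\<And>t. t \<ge> 0 \<Longrightarrow> \<bar>\<Sum>a\<in>A. c a * exp (- a * t)\<bar> \<le> M * exp (- t)"
  shows "\<bar>c x\<bar> \<le> M * exp ((5 / \<Delta> + 4 * C + 1) * x)"
proof -
  define Q where "Q = (\<Prod>b\<in>A - {x}. (x - b) / (x + b))"
  define P where "P = (\<Prod>b\<in>A - {x}. (x + b) / \<bar>x - b\<bar>)"
  have x: "x > 0" using assms by auto
  have M: "M \<ge> 0" using bound[of 0] by simp
  \<comment> \<open>Multiplying by \<open>P\<close> undoes the damping \<open>Q\<close> of the
    filters and recovers the bare coefficient.\<close>
  have QP: "\<bar>Q\<bar> * P = 1"
    unfolding Q_def P_def abs_prod prod.distrib[symmetric]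
  proof (intro prod.neutral ballI)
    fix b assume b: "b \<in> A - {x}"
    then have "x + b > 0" using x pos by (simp add: add_pos_pos)
    then show "\<bar>(x - b) / (x + b)\<bar> * ((x + b) / \<bar>x - b\<bar>) = 1"
      using b by (simp add: abs_divide)
  qed
  have P0: "P \<ge> 0"
    unfolding P_def using pos x
    by (intro prod_nonneg) (force intro!: divide_nonneg_nonneg add_nonneg_nonneg intro: less_imp_le)
  have "(c x * Q)\<^sup>2 / (2 * x) \<le> exp_gram A c"
    unfolding Q_def by (rule exp_gram_coefficient_le[OF assms(1,2) pos])
  also have "\<dots> \<le> M\<^sup>2 / 2"
    by (rule exp_gram_le[OF assms(1) pos bound])
  finally have "(c x * Q)\<^sup>2 \<le> M\<^sup>2 * x" using x by (simp add: field_simps)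
  \<comment> \<open>Absorbing \<open>x\<close> into \<open>exp (2 * x)\<close> costs
    \<open>exp x\<close> after the square root: this is the summand 1 in the final exponent.\<close>
  also have "\<dots> \<le> M\<^sup>2 * exp (2 * x)"
    using exp_ge_add_one_self[of "2 * x"] x by (intro mult_left_mono) (linarith, simp)
  also have "\<dots> = (M * exp x)\<^sup>2"
    by (simp add: power_mult_distrib power2_eq_square flip: exp_add)
  finally have "\<bar>c x * Q\<bar> \<le> M * exp x"
    using M by (simp add: abs_le_square_iff[symmetric])
  then have "\<bar>c x * Q\<bar> * P \<le> (M * exp x) * exp ((5 / \<Delta> + 4 * C) * x)"
    using blaschke_prod_le[OF assms(1-3) pos gap C] M P0
    by (intro mult_mono) (auto simp: P_def)
  moreover have "\<bar>c x * Q\<bar> * P = \<bar>c x\<bar>"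
    using QP by (simp add: abs_mult mult.assoc)
  moreover have "(M * exp x) * exp ((5 / \<Delta> + 4 * C) * x) = M * exp ((5 / \<Delta> + 4 * C + 1) * x)"
    by (simp add: algebra_simps flip: exp_add)
  ultimately show ?thesis by simp
qed

lemma exp_sum_lipschitz:
  fixes A :: "real set"
  defines "K \<equiv> \<lambda>\<Delta> C. 5 / \<Delta> + 4 * C + 1 :: real"
  assumes "finite A" "\<Delta> > 0" and pos: "\<And>a. a \<in> A \<Longrightarrow> a > 0"
    and gap: "\<And>a b. a \<in> A \<Longrightarrow> b \<in> A \<Longrightarrow> a < b \<Longrightarrow> b - a \<ge> \<Delta>"
    and C: "(\<Sum>a\<in>A. 1 / a) \<le> C"
    and bound: "\<And>t. t \<ge> 0 \<Longrightarrow> \<bar>\<Sum>a\<in>A. c a * exp (- a * t)\<bar> \<le> M"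
    and st: "s \<ge> K \<Delta> C + 1" "s \<le> t"
  shows "\<bar>(\<Sum>a\<in>A. c a * exp (- a * s)) - (\<Sum>a\<in>A. c a * exp (- a * t))\<bar>
    \<le> 2 * C * exp (K \<Delta> C) * M * (t - s)"
proof -
  have M: "M \<ge> 0" using bound[of 0] by simp
  have coeff: "\<bar>c x\<bar> \<le> M * exp (K \<Delta> C * (x + 1))" if "x \<in> A" for x
  proof -
    \<comment> \<open>Raising all exponents by 1 multiplies the sum by \<open>exp (- t)\<close> and
      so supplies the decay that the coefficient bound demands. Gaps are unchanged and reciprocals
      only shrink. The term \<open>(x + 1) - 1\<close> matches the shifted coefficient
      function.\<close>
    have "\<bar>c ((x + 1) - 1)\<bar> \<le> M * exp ((5 / \<Delta> + 4 * C + 1) * (x + 1))"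
    proof (rule exp_sum_coefficient_le[where A = "(\<lambda>a. a + 1) ` A" and c = "\<lambda>a. c (a - 1)"])
      have "(\<Sum>a\<in>(\<lambda>a. a + 1) ` A. 1 / a) = (\<Sum>a\<in>A. 1 / (a + 1))"
        by (subst sum.reindex) (auto simp: inj_on_def)
      also have "\<dots> \<le> (\<Sum>a\<in>A. 1 / a)"
        using pos by (intro sum_mono divide_left_mono) (auto intro!: mult_pos_pos dest: pos)
      finally show "(\<Sum>a\<in>(\<lambda>a. a + 1) ` A. 1 / a) \<le> C" using C by simp
    next
      fix t :: real assume "t \<ge> 0"
      have "(\<Sum>a\<in>(\<lambda>a. a + 1) ` A. c (a - 1) * exp (- a * t)) = (\<Sum>a\<in>A. c a * exp (- (a + 1) * t))"
        by (subst sum.reindex) (simp_all only: inj_on_add' o_def add_diff_cancel_right')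
      also have "\<dots> = (\<Sum>a\<in>A. c a * exp (- a * t)) * exp (- t)"
        unfolding sum_distrib_right
        by (intro sum.cong) (auto simp: ring_distribs exp_add exp_diff exp_minus field_simps)
      finally show "\<bar>\<Sum>a\<in>(\<lambda>a. a + 1) ` A. c (a - 1) * exp (- a * t)\<bar> \<le> M * exp (- t)"
        using bound[OF \<open>t \<ge> 0\<close>] by (simp add: abs_mult)
    qed (use assms that in \<open>auto dest: pos\<close>)
    then show ?thesis by (simp add: K_def)
  qed
  have "\<bar>(\<Sum>a\<in>A. c a * exp (- a * s)) - (\<Sum>a\<in>A. c a * exp (- a * t))\<bar>
      = \<bar>\<Sum>a\<in>A. c a * (exp (- a * s) - exp (- a * t))\<bar>"
    by (simp add: sum_subtractf right_diff_distrib)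
  also have "\<dots> \<le> (\<Sum>a\<in>A. \<bar>c a * (exp (- a * s) - exp (- a * t))\<bar>)" by (rule sum_abs)
  also have "\<dots> \<le> (\<Sum>a\<in>A. (2 * exp (K \<Delta> C) * M * (t - s)) * (1 / a))"
  proof (intro sum_mono)
    fix a assume a: "a \<in> A"
    then have a0: "a > 0" using pos by auto
    have "exp (- a * s) - exp (- a * t) = exp (- a * s) * (1 - exp (- (a * (t - s))))"
      by (simp add: algebra_simps flip: exp_add)
    moreover have "1 - exp (- (a * (t - s))) \<le> a * (t - s)"
      using exp_ge_add_one_self[of "- (a * (t - s))"] by simp
    ultimately have 1: "exp (- a * s) - exp (- a * t) \<le> exp (- a * s) * (a * (t - s))"
      by simp
    have 2: "exp (- a * s) - exp (- a * t) \<ge> 0" using a0 st by simp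
    have "exp (- a * s) \<le> exp (- a * (K \<Delta> C + 1))" using a0 st by simp
    then have "exp (- a * s) * (a * (t - s)) \<le> exp (- a * (K \<Delta> C + 1)) * (a * (t - s))"
      using a0 st by (intro mult_right_mono) auto
    with 1 have 3: "exp (- a * s) - exp (- a * t) \<le> exp (- a * (K \<Delta> C + 1)) * (a * (t - s))"
      by linarith
    have "\<bar>c a * (exp (- a * s) - exp (- a * t))\<bar>
        \<le> M * exp (K \<Delta> C * (a + 1)) * (exp (- a * (K \<Delta> C + 1)) * (a * (t - s)))"
      unfolding abs_mult using coeff[OF a] 2 3 M by (intro mult_mono) auto
    \<comment> \<open>Starting the half line at \<open>K \<Delta> C + 1\<close> rather than at
      \<open>K \<Delta> C\<close> leaves a factor \<open>exp (- a)\<close> after the coefficient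
      growth has been cancelled.\<close>
    also have "\<dots> = M * (exp (K \<Delta> C) * exp (- a)) * (a * (t - s))"
      by (simp add: algebra_simps flip: exp_add)
    also have "\<dots> = exp (K \<Delta> C) * M * (t - s) * (a * exp (- a))"
      by (simp add: mult_ac)
    \<comment> \<open>The spare decay is traded for \<open>1 / a\<close>, so that the sum over
      \<open>A\<close> is controlled by \<open>C\<close> and not by the number of exponents.\<close>
    also have "\<dots> \<le> exp (K \<Delta> C) * M * (t - s) * (2 / a)"
    proof (intro mult_left_mono)
      have "a\<^sup>2 / 2 \<le> exp a"
        using exp_lower_Taylor_quadratic[of a] a0 by simp
      then show "a * exp (- a) \<le> 2 / a"
        using a0 by (simp add: exp_minus field_simps power2_eq_square)
    qed (use M st in auto)
    finally show "\<bar>c a * (exp (- a * s) - exp (- a * t))\<bar> \<le> (2 * exp (K \<Delta> C) * M * (t - s)) * (1 / a)"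
      by (simp add: mult_ac)
  qed
  also have "\<dots> = (2 * exp (K \<Delta> C) * M * (t - s)) * (\<Sum>a\<in>A. 1 / a)"
    by (simp add: sum_distrib_left)
  also have "\<dots> \<le> (2 * exp (K \<Delta> C) * M * (t - s)) * C"
    using C M st by (intro mult_left_mono) auto
  finally show ?thesis by (simp add: mult_ac)
qed

section \<open>From finite sums to the spaces \<open>Exp\<close>\<close>

lemma bounded_linear_apply_Cinf:
  assumes "t \<ge> 0"
  shows "bounded_linear (\<lambda>f. apply_Cinf f t)"
  by (rule bounded_linear_intro[where K = 1])
    (use norm_Cinf_upper[OF assms] in \<open>auto simp: plus_Cinf.rep_eq scaleR_Cinf.rep_eq\<close>)

lemma apply_Cinf_sum: "apply_Cinf (sum f A) t = (\<Sum>a\<in>A. apply_Cinf (f a) t)"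
  by (induction A rule: infinite_finite_induct) (auto simp: zero_Cinf.rep_eq plus_Cinf.rep_eq)

text \<open>The gap condition concerns neighbouring indices only; since \<open>\<alpha>\<close>
  increases, \<open>\<alpha> (j + 1)\<close> already lies between \<open>\<alpha> j\<close> and
  \<open>\<alpha> k\<close>.\<close>

lemma gap_condition_less:
  assumes "gap_condition \<Delta> \<alpha> n" "strict_mono_on (I_upto n) \<alpha>"
    and "j \<in> I_upto n" "k \<in> I_upto n" "\<alpha> j < \<alpha> k"
  shows "\<alpha> k - \<alpha> j \<ge> \<Delta>"
proof -
  have "j < k"
    using assms(2-5) by (metis linorder_neqE_nat order_less_irrefl order_less_trans strict_mono_onD)
  then have j: "j + 1 \<in> I_upto n" "j + 1 \<le> k"
    using assms(4) by (auto simp: I_upto_def intro: order_trans[of _ "enat k"])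
  then have "\<alpha> (j + 1) \<le> \<alpha> k"
    using assms(2,4) by (metis le_neq_implies_less less_imp_le order_refl strict_mono_onD)
  moreover have "\<alpha> (j + 1) - \<alpha> j \<ge> \<Delta>"
    using assms(1,3) j by (auto simp: gap_condition_def)
  ultimately show ?thesis by simp
qed

lemma sum_inverse_le_reciprocal_sum:
  assumes "reciprocal_sum \<alpha> n \<le> ennreal C" "C \<ge> 0" "finite J" "J \<subseteq> I_upto n"
    and "\<And>k. k \<in> J \<Longrightarrow> \<alpha> k > 0"
  shows "(\<Sum>k\<in>J. 1 / \<alpha> k) \<le> C"
proof -
  have "ennreal (\<Sum>k\<in>J. 1 / \<alpha> k) = (\<Sum>k\<in>J. ennreal (1 / \<alpha> k))"
    using assms(5) by (intro sum_ennreal[symmetric]) (auto simp: less_imp_le)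
  also have "\<dots> \<le> reciprocal_sum \<alpha> n"
    unfolding reciprocal_sum_def
    by (subst nonneg_infsum_complete) (use assms in \<open>auto intro!: SUP_upper\<close>)
  also note assms(1)
  finally show ?thesis using assms(2) by simp
qed

text \<open>The functional \<open>\<phi>\<close> treats both scalar fields at once: being
  real-linear and bounded by the norm, it turns an element of the span into a real exponential sum
  bounded by \<open>norm f\<close>.\<close>

lemma Exp_lipschitz:
  fixes \<phi> :: "'k::real_normed_field \<Rightarrow> real" and f :: "'k Cinf"
  defines "K \<equiv> \<lambda>\<Delta> C. 5 / \<Delta> + 4 * C + 1 :: real"
  assumes \<phi>: "bounded_linear \<phi>" "\<And>z. \<bar>\<phi> z\<bar> \<le> norm z"
    and pos: "\<And>k. k \<in> I_upto n \<Longrightarrow> 0 < \<alpha> k"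
    and mono: "strict_mono_on (I_upto n) \<alpha>"
    and gap: "\<Delta> > 0" "gap_condition \<Delta> \<alpha> n"
    and C: "C \<ge> 0" "reciprocal_sum \<alpha> n \<le> ennreal C"
    and f: "f \<in> Exp \<alpha> n"
    and st: "s \<ge> K \<Delta> C + 1" "s \<le> t"
  shows "\<bar>\<phi> (apply_Cinf f s) - \<phi> (apply_Cinf f t)\<bar> \<le> 2 * C * exp (K \<Delta> C) * norm f * (t - s)"
proof -
  interpret \<phi>: bounded_linear \<phi> by fact
  have "K \<Delta> C \<ge> 0" using gap C by (simp add: K_def)
  then have s0: "s \<ge> 0" "t \<ge> 0" using st by auto
  have span: "\<bar>\<phi> (apply_Cinf g s) - \<phi> (apply_Cinf g t)\<bar> \<le> 2 * C * exp (K \<Delta> C) * norm g * (t - s)"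
    if g: "g \<in> span_Cinf ((\<lambda>k. exp_Cinf (\<alpha> k)) ` I_upto n)" for g :: "'k Cinf"
  proof -
    obtain T r where T: "finite T" "T \<subseteq> (\<lambda>k. exp_Cinf (\<alpha> k)) ` I_upto n"
      and gT: "g = (\<Sum>v\<in>T. scale_Cinf (r v) v)"
      using g unfolding Cinf.span_explicit mem_Collect_eq by (elim exE conjE)
    \<comment> \<open>Choosing one index per function in \<open>T\<close> makes the reindexing
      injective without comparing exponentials of distinct exponents.\<close>
    obtain J where J: "J \<subseteq> I_upto n" "inj_on (\<lambda>k. exp_Cinf (\<alpha> k) :: 'k Cinf) J"
        "T = (\<lambda>k. exp_Cinf (\<alpha> k)) ` J"
      using T(2) by (meson subset_image_inj)
    then have finJ: "finite J" using T(1) finite_imageD by blast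
    have inj: "inj_on \<alpha> (I_upto n)" using mono by (rule strict_mono_on_imp_inj_on)
    define c where "c = (\<lambda>a. \<phi> (r (exp_Cinf a)))"
    have \<phi>_of_real: "\<phi> (z * of_real x) = \<phi> z * x" for z x
      using \<phi>.scaleR[of x z] by (simp add: scaleR_conv_of_real mult.commute)
    have eq: "\<phi> (apply_Cinf g u) = (\<Sum>a\<in>\<alpha> ` J. c a * exp (- a * u))" if "u \<ge> 0" for u
    proof -
      have "\<phi> (apply_Cinf g u) = (\<Sum>k\<in>J. \<phi> (r (exp_Cinf (\<alpha> k)) * apply_Cinf (exp_Cinf (\<alpha> k)) u))"
        unfolding gT J(3) sum.reindex[OF J(2)] apply_Cinf_sum \<phi>.sum
        by (simp add: scale_Cinf.rep_eq)
      also have "\<dots> = (\<Sum>k\<in>J. c (\<alpha> k) * exp (- \<alpha> k * u))"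
        using J(1) pos that
        by (intro sum.cong refl) (subst exp_Cinf_apply, auto simp: \<phi>_of_real c_def)
      also have "\<dots> = (\<Sum>a\<in>\<alpha> ` J. c a * exp (- a * u))"
        using inj J(1) by (subst sum.reindex) (auto intro: inj_on_subset)
      finally show ?thesis .
    qed
    show ?thesis
      unfolding eq[OF s0(1)] eq[OF s0(2)] K_def
    proof (rule exp_sum_lipschitz)
      show "\<bar>\<Sum>a\<in>\<alpha> ` J. c a * exp (- a * u)\<bar> \<le> norm g" if "u \<ge> 0" for u
        using \<phi>(2)[of "apply_Cinf g u"] norm_Cinf_upper[OF that, of g] eq[OF that] by simp
      show "(\<Sum>a\<in>\<alpha> ` J. 1 / a) \<le> C"
        using inj J(1) sum_inverse_le_reciprocal_sum[OF C(2,1) finJ J(1)] pos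
        by (subst sum.reindex) (auto intro: inj_on_subset)
    qed (use finJ J(1) pos gap(1) st gap_condition_less[OF gap(2) mono] in
        \<open>auto simp: K_def subset_iff\<close>)
  qed
  obtain g where g: "\<And>i. g i \<in> span_Cinf ((\<lambda>k. exp_Cinf (\<alpha> k)) ` I_upto n)" "g \<longlonglongrightarrow> f"
    using f unfolding Exp_def closure_sequential by blast
  show ?thesis
  \<comment> \<open>Both sides of the estimate are continuous in the norm of \<open>Cinf\<close>, so
    it passes from the span to its closure.\<close>
  proof (rule LIMSEQ_le)
    show "(\<lambda>i. \<bar>\<phi> (apply_Cinf (g i) s) - \<phi> (apply_Cinf (g i) t)\<bar>)
        \<longlonglongrightarrow> \<bar>\<phi> (apply_Cinf f s) - \<phi> (apply_Cinf f t)\<bar>"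
      by (intro tendsto_intros \<phi>.tendsto bounded_linear.tendsto[OF bounded_linear_apply_Cinf] s0 g)
    show "(\<lambda>i. 2 * C * exp (K \<Delta> C) * norm (g i) * (t - s)) \<longlonglongrightarrow> 2 * C * exp (K \<Delta> C) * norm f * (t - s)"
      by (intro tendsto_intros g)
  qed (use span g in blast)
qed

section \<open>A function that is not representable\<close>

lemma ex_Cinf_sqrt_cusp:
  assumes "t\<^sub>0 \<ge> 1"
  shows "\<exists>f :: 'k::real_normed_field Cinf.
    \<forall>h\<in>{0..1}. apply_Cinf f (t\<^sub>0 + h) = of_real (1 - sqrt h)"
proof -
  \<comment> \<open>The truncation at 0 confines the support to distance 1 from the cusp;
    \<open>t\<^sub>0 \<ge> 1\<close> then yields the required zeros at negative arguments.\<close>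
  define F where "F = (\<lambda>t. of_real (max 0 (1 - sqrt \<bar>t - t\<^sub>0\<bar>)) :: 'k)"
  have zero: "F t = 0" if "\<bar>t - t\<^sub>0\<bar> \<ge> 1" for t
    using that by (simp add: F_def max_def)
  have "continuous_on {0..} F"
    unfolding F_def by (intro continuous_intros)
  moreover have "(F \<longlongrightarrow> 0) at_top"
    by (rule tendsto_eventually)
      (use zero in \<open>auto simp: eventually_at_top_linorder intro!: exI[of _ "t\<^sub>0 + 1"]\<close>)
  moreover have "\<forall>t<0. F t = 0" using assms by (intro allI impI zero) auto
  ultimately have "apply_Cinf (Cinf F) = F" by (intro Cinf_inverse) auto
  then show ?thesis
    by (intro exI[of _ "Cinf F"]) (auto simp: F_def max_def)
qed

lemma not_ARFS_Exp:
  fixes \<Lambda> :: "'i set" and n :: "'i \<Rightarrow> enat" and \<alpha> :: "'i \<Rightarrow> nat \<Rightarrow> real"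
    and \<phi> :: "'k::{real_normed_field,banach} \<Rightarrow> real"
  assumes \<phi>: "bounded_linear \<phi>" "\<And>z. \<bar>\<phi> z\<bar> \<le> norm z" "\<And>r. \<phi> (of_real r) = r"
    and pos: "\<And>l k. l \<in> \<Lambda> \<Longrightarrow> k \<in> I_upto (n l) \<Longrightarrow> 0 < \<alpha> l k"
    and mono: "\<And>l. l \<in> \<Lambda> \<Longrightarrow> strict_mono_on (I_upto (n l)) (\<alpha> l)"
    and gap: "\<Delta> > 0" "\<And>l. l \<in> \<Lambda> \<Longrightarrow> gap_condition \<Delta> (\<alpha> l) (n l)"
    and C: "C \<ge> 0" "\<And>l. l \<in> \<Lambda> \<Longrightarrow> reciprocal_sum (\<alpha> l) (n l) \<le> ennreal C"
  shows "\<not> ARFS \<Lambda> (\<lambda>l. Exp (\<alpha> l) (n l) :: 'k Cinf set)"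
proof
  assume "ARFS \<Lambda> (\<lambda>l. Exp (\<alpha> l) (n l) :: 'k Cinf set)"
  note ARFS = this[unfolded ARFS_def, rule_format]
  define K where "K = 5 / \<Delta> + 4 * C + 1"
  define L where "L = 2 * C * exp K"
  have K: "K \<ge> 0" "L \<ge> 0" using gap C by (auto simp: K_def L_def)
  \<comment> \<open>The cusp sits at \<open>K + 1\<close>, the left end of the common half line, so
    only increments to the right of it are used.\<close>
  obtain f :: "'k Cinf" where f: "\<And>h. h \<in> {0..1} \<Longrightarrow> apply_Cinf f (K + 1 + h) = of_real (1 - sqrt h)"
    using ex_Cinf_sqrt_cusp[of "K + 1", where 'k = 'k] K by force
  obtain y where y: "\<And>l. l \<in> \<Lambda> \<Longrightarrow> y l \<in> Exp (\<alpha> l) (n l)"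
      "(\<lambda>l. norm (y l)) summable_on \<Lambda>" "(y has_sum f) \<Lambda>"
    using ARFS[of f] by blast
  define B where "B = L * infsum (\<lambda>l. norm (y l)) \<Lambda>"
  have lip: "sqrt h \<le> B * h" if h: "h \<in> {0..1}" for h
  proof -
    have pt: "bounded_linear (\<lambda>g. \<phi> (apply_Cinf g (K + 1 + h)))" if "h \<ge> 0" for h
      using that K by (intro bounded_linear_compose[OF \<phi>(1)] bounded_linear_apply_Cinf) auto
    \<comment> \<open>The increment is a bounded linear functional, so it may be applied termwise to
      the sum; each term is at most \<open>L * h * norm (y l)\<close>.\<close>
    have bl: "bounded_linear (\<lambda>g. \<phi> (apply_Cinf g (K + 1 + 0)) - \<phi> (apply_Cinf g (K + 1 + h)))"
      using h by (intro bounded_linear_sub pt) auto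
    have "norm (\<phi> (apply_Cinf f (K + 1 + 0)) - \<phi> (apply_Cinf f (K + 1 + h)))
        \<le> L * h * infsum (\<lambda>l. norm (y l)) \<Lambda>"
    proof (rule norm_infsum_le[OF has_sum_bounded_linear[OF bl y(3)]
          has_sum_cmult_right[OF has_sum_infsum[OF y(2)]]])
      fix l assume l: "l \<in> \<Lambda>"
      show "norm (\<phi> (apply_Cinf (y l) (K + 1 + 0)) - \<phi> (apply_Cinf (y l) (K + 1 + h)))
          \<le> L * h * norm (y l)"
        using Exp_lipschitz[OF \<phi>(1,2) pos[OF l] mono[OF l] gap(1) gap(2)[OF l] C(1) C(2)[OF l] y(1)[OF l],
            of "K + 1" "K + 1 + h"] h
        by (simp add: K_def L_def mult_ac)
    qed
    moreover have "\<phi> (apply_Cinf f (K + 1 + h')) = 1 - sqrt h'" if "h' \<in> {0..1}" for h'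
      unfolding f[OF that] by (rule \<phi>(3))
    from this[of 0] this[OF h]
    have "norm (\<phi> (apply_Cinf f (K + 1 + 0)) - \<phi> (apply_Cinf f (K + 1 + h))) = sqrt h"
      using h by simp
    ultimately show ?thesis by (simp add: B_def mult_ac)
  qed
  \<comment> \<open>For this \<open>h\<close> the square root is \<open>1 / (B + 2)\<close>, and
    \<open>sqrt h \<le> B * h\<close> becomes the absurd \<open>B + 2 \<le> B\<close>. The 2 also
    keeps \<open>h\<close> in the unit interval.\<close>
  define h where "h = 1 / (B + 2)\<^sup>2"
  have B: "B \<ge> 0" using K by (auto simp: B_def intro!: mult_nonneg_nonneg infsum_nonneg)
  then have "(B + 2)\<^sup>2 \<ge> 1" by (intro one_le_power) auto
  then have "h \<in> {0..1}" by (auto simp: h_def divide_le_eq_1 not_le)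
  from lip[OF this] have "1 / (B + 2) \<le> B / (B + 2)\<^sup>2"
    using B by (simp add: h_def real_sqrt_divide)
  then have "1 / (B + 2) * (B + 2)\<^sup>2 \<le> B / (B + 2)\<^sup>2 * (B + 2)\<^sup>2"
    by (rule mult_right_mono) simp
  moreover have "1 / (B + 2) * (B + 2)\<^sup>2 = B + 2" "B / (B + 2)\<^sup>2 * (B + 2)\<^sup>2 = B"
    using B by (simp_all add: power2_eq_square)
  ultimately have "B + 2 \<le> B" by simp
  then show False by simp
qed

theorem theorem7p2:
  fixes \<Lambda> :: "'i set" and n :: "'i \<Rightarrow> enat" and \<alpha> :: "'i \<Rightarrow> nat \<Rightarrow> real"
  assumes "\<Lambda> \<noteq> {}"
    and "\<And>l. l \<in> \<Lambda> \<Longrightarrow> 1 \<le> n l"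
    and "\<And>l k. l \<in> \<Lambda> \<Longrightarrow> k \<in> I_upto (n l) \<Longrightarrow> 0 < \<alpha> l k"
    and "\<And>l. l \<in> \<Lambda> \<Longrightarrow> strict_mono_on (I_upto (n l)) (\<alpha> l)"
    and "\<exists>\<Delta>>0. \<forall>l\<in>\<Lambda>. gap_condition \<Delta> (\<alpha> l) (n l)"
    and "\<exists>C::real. \<forall>l\<in>\<Lambda>. reciprocal_sum (\<alpha> l) (n l) \<le> ennreal C"
  shows "\<not> ARFS \<Lambda> (\<lambda>l. Exp (\<alpha> l) (n l) :: real Cinf set)
       \<and> \<not> ARFS \<Lambda> (\<lambda>l. Exp (\<alpha> l) (n l) :: complex Cinf set)"
proof -
  obtain \<Delta> C where gap: "\<Delta> > 0" "\<And>l. l \<in> \<Lambda> \<Longrightarrow> gap_condition \<Delta> (\<alpha> l) (n l)"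
    and C: "\<And>l. l \<in> \<Lambda> \<Longrightarrow> reciprocal_sum (\<alpha> l) (n l) \<le> ennreal C"
    using assms(5,6) by blast
  \<comment> \<open>The given bound \<open>C\<close> may be negative, in which case
    \<open>ennreal C\<close> is 0.\<close>
  have C': "max C 0 \<ge> 0" "\<And>l. l \<in> \<Lambda> \<Longrightarrow> reciprocal_sum (\<alpha> l) (n l) \<le> ennreal (max C 0)"
    using order_trans[OF C ennreal_leI[of C "max C 0"]] by auto
  show ?thesis
  proof
    show "\<not> ARFS \<Lambda> (\<lambda>l. Exp (\<alpha> l) (n l) :: real Cinf set)"
      using not_ARFS_Exp[OF bounded_linear_ident _ _ assms(3,4) gap C'] by simp
    show "\<not> ARFS \<Lambda> (\<lambda>l. Exp (\<alpha> l) (n l) :: complex Cinf set)"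
      using not_ARFS_Exp[OF bounded_linear_Re abs_Re_le_cmod _ assms(3,4) gap C'] by simp
  qed
qed

end
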